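(* Let $M$ be a compact surface, let $2\le r\le\infty$, and let $\mathcal N^r\subset \mathrm{Diff}^r(M)$ be a non-empty open set, as provided by Turaev's theorem, which admits a dense subset $\mathcal D\subset \mathcal N^r$ such that for every $f\in\mathcal D$ there exist a non-empty open set $U\subset M$ and an integer $N\ge 1$ with $f^N|_U=\mathrm{id}|_U$. Let $(\mathscr P)$ be a generically localizable property on $\mathrm{Diff}^r(M)$. Then $(\mathscr P)$ is locally generic: there exists a topologically generic subset $\mathcal R\subset\mathcal N^r$ such that every $f\in\mathcal R$ satisfies $(\mathscr P)$.
   Context: $\mathrm{Diff}^r(M)$ is the space of $C^r$-diffeomorphisms of the compact manifold $M$, endowed with its canonical $C^r$-topology. A property on $\mathrm{Diff}^r(M)$ is a predicate on its elements. That there is a $C^r$-perturbation $\tilde f$ of $f$ with a given feature means that every $C^r$-neighborhood of $f$ contains such an $\tilde f$. A property $(\mathscr P)$ on $\mathrm{Diff}^r(M)$ is localizable if for every non-empty open set $U\subset M$, every $N\ge 1$ and every $f\in\mathrm{Diff}^r(M)$ with $f^N|_U=\mathrm{id}|_U$, there exists a $C^r$-perturbation $\tilde f$ of $f$ which satisfies $(\mathscr P)$. It is openly localizable if moreover the perturbation $\tilde f$ can be chosen in a $C^r$-open set of diffeomorphisms all satisfying $(\mathscr P)$. It is generically localizable if there is a countable family $\{(\mathscr P_i): i\ge 0\}$ of openly localizable properties whose conjunction implies it: $\bigwedge_i(\mathscr P_i)\Rightarrow(\mathscr P)$. A subset of $\mathcal N^r$ is topologically generic if it contains a countable intersection of open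 and dense subsets of $\mathcal N^r$. Turaev's theorem: for every surface $M$ and $r\ge 2$, there is a non-empty open set $\mathcal N^r\subset\mathrm{Diff}^r(M)$ and a dense subset $\mathcal D\subset\mathcal N^r$ such that for every $f\in\mathcal D$ there exist a non-empty open set $U\subset M$ and $N\ge1$ such that $f^N|_U=\mathrm{id}|_U$. *)

theory Defs
  imports "HOL-Analysis.Analysis" "HOL-Library.Extended_Nat"
begin

subsection \<open>Maps of class \<open>C\<^sup>k\<close> between Euclidean spaces\<close>

text \<open>
  \<open>Ck_on k S f\<close>, for an open set \<open>S\<close>. The derivatives are taken in each fixed direction \<open>v\<close>;
  in finite dimension this amounts to continuity of the iterated Frechet derivatives.
\<close>

primrec Ck_on ::
  "nat \<Rightarrow> 'e::euclidean_space set \<Rightarrow> ('e \<Rightarrow> 'f::real_normed_vector) \<Rightarrow> bool" where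
  "Ck_on 0 S f \<longleftrightarrow> continuous_on S f"
| "Ck_on (Suc k) S f \<longleftrightarrow>
     (\<forall>x\<in>S. f differentiable (at x)) \<and> (\<forall>v. Ck_on k S (\<lambda>x. frechet_derivative f (at x) v))"

text \<open>Regularity \<open>r \<in> \<nat> \<union> {\<infinity>}\<close>.\<close>

definition Cr_on ::
  "enat \<Rightarrow> 'e::euclidean_space set \<Rightarrow> ('e \<Rightarrow> 'f::real_normed_vector) \<Rightarrow> bool" where
  "Cr_on r S f \<longleftrightarrow> (\<forall>k. enat k \<le> r \<longrightarrow> Ck_on k S f)"

text \<open>
  Iterated directional derivative of \<open>f\<close> in the listed directions. With directions in \<open>Basis\<close>
  these are the partial derivatives, the order being the length of the list.
\<close>

primrec iter_deriv ::
  "'e list \<Rightarrow> ('e::euclidean_space \<Rightarrow> 'f::real_normed_vector) \<Rightarrow> 'e \<Rightarrow> 'f" where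
  "iter_deriv [] f = f"
| "iter_deriv (v # vs) f = iter_deriv vs (\<lambda>x. frechet_derivative f (at x) v)"


subsection \<open>Compact surfaces\<close>

text \<open>
  The surface is the whole type \<open>'a\<close>. A chart is a pair \<open>(U, \<phi>)\<close> of its domain and the chart
  map; the values of \<open>\<phi>\<close> outside \<open>U\<close> are irrelevant. An atlas is not required to be maximal:
  the notions below depend only on the smooth structure that it generates.
\<close>

type_synonym 'a chart = "'a set \<times> ('a \<Rightarrow> real ^ 2)"

definition local_rep :: "'a chart \<Rightarrow> 'a chart \<Rightarrow> ('a \<Rightarrow> 'a) \<Rightarrow> real ^ 2 \<Rightarrow> real ^ 2" where
  "local_rep c d f = snd d \<circ> f \<circ> inv_into (fst c) (snd c)"

definition smooth_atlas :: "'a::topological_space chart set \<Rightarrow> bool" where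
  "smooth_atlas A \<longleftrightarrow>
     (\<Union>c\<in>A. fst c) = UNIV \<and>
     (\<forall>(U, \<phi>)\<in>A. open U \<and> open (\<phi> ` U) \<and> homeomorphism U (\<phi> ` U) \<phi> (inv_into U \<phi>)) \<and>
     (\<forall>c\<in>A. \<forall>d\<in>A. Cr_on \<infinity> (snd c ` (fst c \<inter> fst d)) (local_rep c d id))"

text \<open>
  A closed surface (compact, without boundary); second countability follows from compactness.
\<close>

definition compact_surface :: "'a::t2_space chart set \<Rightarrow> bool" where
  "compact_surface A \<longleftrightarrow> compact (UNIV :: 'a set) \<and> smooth_atlas A"


subsection \<open>Diffeomorphisms and the \<open>C\<^sup>r\<close>-topology\<close>

definition Cr_map :: "'a::topological_space chart set \<Rightarrow> enat \<Rightarrow> ('a \<Rightarrow> 'a) \<Rightarrow> bool" where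
  "Cr_map A r f \<longleftrightarrow>
     continuous_on UNIV f \<and>
     (\<forall>c\<in>A. \<forall>d\<in>A. Cr_on r (snd c ` (fst c \<inter> f -` fst d)) (local_rep c d f))"

definition Diff :: "'a::topological_space chart set \<Rightarrow> enat \<Rightarrow> ('a \<Rightarrow> 'a) set" where
  "Diff A r = {f. bij f \<and> Cr_map A r f \<and> Cr_map A r (inv f)}"

text \<open>
  The subbasic neighbourhood of \<open>f\<close> given by charts \<open>c\<close> and \<open>d\<close>, a compact set
  \<open>K \<subseteq> fst c\<close> with \<open>f ` K \<subseteq> fst d\<close>, an order \<open>k\<close> and \<open>\<epsilon> > 0\<close>: on \<open>K\<close>, all partial
  derivatives of order at most \<open>k\<close> of the local representatives are \<open>\<epsilon>\<close>-close.
\<close>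

definition Cr_nbhd ::
  "'a::topological_space chart set \<Rightarrow> enat \<Rightarrow> ('a \<Rightarrow> 'a) \<Rightarrow> 'a chart \<Rightarrow> 'a chart \<Rightarrow> 'a set
    \<Rightarrow> nat \<Rightarrow> real \<Rightarrow> ('a \<Rightarrow> 'a) set" where
  "Cr_nbhd A r f c d K k \<epsilon> =
     {g \<in> Diff A r. g ` K \<subseteq> fst d \<and>
        (\<forall>x \<in> snd c ` K. \<forall>vs. set vs \<subseteq> Basis \<and> length vs \<le> k \<longrightarrow>
           norm (iter_deriv vs (local_rep c d g) x - iter_deriv vs (local_rep c d f) x) < \<epsilon>)}"

text \<open>
  For finite \<open>r\<close> this is the compact-open \<open>C\<^sup>r\<close>-topology, and for \<open>r = \<infinity>\<close> the union of
  the \<open>C\<^sup>k\<close>-topologies over all finite \<open>k\<close>.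
\<close>

definition Cr_topology :: "'a::topological_space chart set \<Rightarrow> enat \<Rightarrow> ('a \<Rightarrow> 'a) topology" where
  "Cr_topology A r = topology_generated_by
     (insert (Diff A r)
       {Cr_nbhd A r f c d K k \<epsilon> | f c d K k \<epsilon>.
          f \<in> Diff A r \<and> c \<in> A \<and> d \<in> A \<and> compact K \<and> K \<subseteq> fst c \<and> f ` K \<subseteq> fst d \<and>
          enat k \<le> r \<and> 0 < \<epsilon>})"

lemma topspace_Cr_topology [simp]: "topspace (Cr_topology A r) = Diff A r"
  unfolding Cr_topology_def topology_generated_by_topspace by (auto simp: Cr_nbhd_def)


subsection \<open>Localizable properties\<close>

definition has_perturbation ::
  "'a::topological_space chart set \<Rightarrow> enat \<Rightarrow> ('a \<Rightarrow> 'a) \<Rightarrow> (('a \<Rightarrow> 'a) \<Rightarrow> bool) \<Rightarrow> bool" where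
  "has_perturbation A r f Q \<longleftrightarrow>
     (\<forall>V. openin (Cr_topology A r) V \<and> f \<in> V \<longrightarrow> (\<exists>g\<in>V. Q g))"

definition localizable ::
  "'a::topological_space chart set \<Rightarrow> enat \<Rightarrow> (('a \<Rightarrow> 'a) \<Rightarrow> bool) \<Rightarrow> bool" where
  "localizable A r P \<longleftrightarrow>
     (\<forall>U N. \<forall>f \<in> Diff A r.
        open U \<and> U \<noteq> {} \<and> N \<ge> 1 \<and> (\<forall>x\<in>U. (f ^^ N) x = x) \<longrightarrow>
        has_perturbation A r f P)"

definition openly_localizable ::
  "'a::topological_space chart set \<Rightarrow> enat \<Rightarrow> (('a \<Rightarrow> 'a) \<Rightarrow> bool) \<Rightarrow> bool" where
  "openly_localizable A r P \<longleftrightarrow>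
     localizable A r P \<and>
     (\<forall>U N. \<forall>f \<in> Diff A r.
        open U \<and> U \<noteq> {} \<and> N \<ge> 1 \<and> (\<forall>x\<in>U. (f ^^ N) x = x) \<longrightarrow>
        has_perturbation A r f
          (\<lambda>g. \<exists>W. openin (Cr_topology A r) W \<and> g \<in> W \<and> (\<forall>h\<in>W. P h)))"

definition generically_localizable ::
  "'a::topological_space chart set \<Rightarrow> enat \<Rightarrow> (('a \<Rightarrow> 'a) \<Rightarrow> bool) \<Rightarrow> bool" where
  "generically_localizable A r P \<longleftrightarrow>
     (\<exists>Q :: nat \<Rightarrow> ('a \<Rightarrow> 'a) \<Rightarrow> bool.
        (\<forall>i. openly_localizable A r (Q i)) \<and>
        (\<forall>f \<in> Diff A r. (\<forall>i. Q i f) \<longrightarrow> P f))"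


subsection \<open>Topological genericity\<close>

definition topologically_generic :: "'b topology \<Rightarrow> 'b set \<Rightarrow> bool" where
  "topologically_generic X R \<longleftrightarrow>
     R \<subseteq> topspace X \<and>
     (\<exists>G :: nat \<Rightarrow> 'b set.
        (\<forall>i. openin X (G i) \<and> X closure_of (G i) = topspace X) \<and> (\<Inter>i. G i) \<subseteq> R)"

end

theory Submission
  imports Defs
begin

text \<open>
  For the openly localizable properties \<open>Q i\<close> behind \<open>P\<close>, the interior of the set where \<open>Q i\<close>
  holds comes arbitrarily close to each point of \<open>\<D>\<close>, so it is dense in \<open>\<N>\<close>. The intersection
  over \<open>i\<close> of these open dense sets is the required generic set.
\<close>

text \<open>Density passes through \<open>D\<close> in two stages: a neighborhood of a point of
  \<open>N\<close> first meets \<open>D\<close>, and around the point of \<open>D\<close> found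
  there \<open>approx\<close> yields a point of the interior of \<open>S\<close>.\<close>

lemma closure_of_interior_of_inter_eq_topspace:
  assumes N: "openin X N" and dense: "N \<subseteq> X closure_of D"
    and approx: "\<And>f V. f \<in> D \<Longrightarrow> openin X V \<Longrightarrow> f \<in> V \<Longrightarrow> V \<inter> X interior_of S \<noteq> {}"
  shows "subtopology X N closure_of (N \<inter> X interior_of S) = topspace (subtopology X N)"
proof -
  have "N \<subseteq> X closure_of (N \<inter> X interior_of S)"
  proof
    fix f assume f: "f \<in> N"
    have "\<exists>g. g \<in> N \<inter> X interior_of S \<and> g \<in> V" if V: "openin X V" "f \<in> V" for V
    proof -
      \<comment> \<open>Shrinking \<open>V\<close> to \<open>V \<inter> N\<close>, open because
        \<open>N\<close> is, forces the point given by \<open>approx\<close> to lie in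
        \<open>N\<close> as well.\<close>
      have VN: "openin X (V \<inter> N)" "f \<in> V \<inter> N"
        using V N f by auto
      then obtain d where "d \<in> D" "d \<in> V \<inter> N"
        using f dense by (metis in_closure_of subsetD)
      then show ?thesis using approx[OF _ VN(1)] by blast
    qed
    moreover have "f \<in> topspace X" using f N openin_subset by blast
    ultimately show "f \<in> X closure_of (N \<inter> X interior_of S)"
      by (simp add: in_closure_of)
  qed
  \<comment> \<open>The closure in the subspace is the trace on \<open>N\<close> of the closure in
    \<open>X\<close>.\<close>
  then show ?thesis
    using openin_subset[OF N] by (auto simp: closure_of_subtopology)
qed

theorem corollary0p3:
  fixes A :: "('a::t2_space) chart set"
    and r :: enat
    and \<N> \<D> :: "('a \<Rightarrow> 'a) set"
    and P :: "('a \<Rightarrow> 'a) \<Rightarrow> bool"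
  assumes "compact_surface A"
    and "2 \<le> r"
    and "openin (Cr_topology A r) \<N>" and "\<N> \<noteq> {}"
    and "\<D> \<subseteq> \<N>" and "\<N> \<subseteq> Cr_topology A r closure_of \<D>"
    and "\<forall>f\<in>\<D>. \<exists>U N. open U \<and> U \<noteq> {} \<and> N \<ge> 1 \<and> (\<forall>x\<in>U. (f ^^ N) x = x)"
    and "generically_localizable A r P"
  shows "\<exists>\<R>. \<R> \<subseteq> \<N> \<and> topologically_generic (subtopology (Cr_topology A r) \<N>) \<R> \<and> (\<forall>f\<in>\<R>. P f)"
proof -
  let ?X = "Cr_topology A r"
  obtain Q :: "nat \<Rightarrow> ('a \<Rightarrow> 'a) \<Rightarrow> bool"
    where Q: "\<And>i. openly_localizable A r (Q i)"
      and QP: "\<And>f. f \<in> Diff A r \<Longrightarrow> (\<And>i. Q i f) \<Longrightarrow> P f"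
    using assms(8) unfolding generically_localizable_def by blast
  have sub: "\<N> \<subseteq> Diff A r"
    using openin_subset[OF assms(3)] by simp
  define G where "G i = \<N> \<inter> ?X interior_of {f. Q i f}" for i
  have "V \<inter> ?X interior_of {f. Q i f} \<noteq> {}" if f: "f \<in> \<D>" and V: "openin ?X V" "f \<in> V" for f V i
  proof -
    have "f \<in> Diff A r" using f assms(5) sub by blast
    with f assms(7) have "has_perturbation A r f
        (\<lambda>g. \<exists>W. openin ?X W \<and> g \<in> W \<and> (\<forall>h\<in>W. Q i h))"
      using Q[of i] unfolding openly_localizable_def by blast
    \<comment> \<open>The open set \<open>W\<close> is what open localizability adds to
      localizability: it places \<open>g\<close> in the interior of the set where \<open>Q i\<close>
      holds, not merely in that set.\<close>
    then obtain g W where "g \<in> V" "openin ?X W" "g \<in> W" "\<forall>h\<in>W. Q i h"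
      using V unfolding has_perturbation_def by blast
    then show ?thesis unfolding interior_of_def by blast
  qed
  then have "subtopology ?X \<N> closure_of G i = topspace (subtopology ?X \<N>)" for i
    unfolding G_def
    by (intro closure_of_interior_of_inter_eq_topspace[OF assms(3) assms(6)])
  moreover have "openin (subtopology ?X \<N>) (G i)" for i
    unfolding G_def by (simp add: openin_subtopology_Int2)
  moreover have G_sub: "(\<Inter>i. G i) \<subseteq> \<N>"
    unfolding G_def by blast
  \<comment> \<open>The intersection itself serves as the generic set; \<open>sub\<close> identifies
    the underlying space of the subtopology with \<open>\<N>\<close>.\<close>
  ultimately have "topologically_generic (subtopology ?X \<N>) (\<Inter>i. G i)"
    using sub unfolding topologically_generic_def
    by (intro conjI exI[of _ G]) auto
  moreover have "P f" if "f \<in> (\<Inter>i. G i)" for f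
  proof (rule QP)
    show "f \<in> Diff A r" using that G_sub sub by blast
    show "Q i f" for i
      using that interior_of_subset[of ?X "{f. Q i f}"] unfolding G_def by blast
  qed
  ultimately show ?thesis using G_sub by blast
qed

end
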